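(* Let $m$ be a positive integer, $q=2^m$, and $\gamma\in\mathbb{F}_{q^3}$. Let $f(X)=X+\gamma\,\mathrm{Tr}_{q}^{q^3}(X^2+X^{q+1})\in\mathbb{F}_{q^3}[X]$. Then $f(X)$ is a permutation polynomial over $\mathbb{F}_{q^3}$ if and only if $\gamma\in\mathbb{F}_q$.
   Context: For a prime power $q$, $\mathbb{F}_q$ is the finite field with $q$ elements. $\mathrm{Tr}_{q}^{q^n}(x)=x+x^q+\cdots+x^{q^{n-1}}$ is the relative trace from $\mathbb{F}_{q^n}$ to $\mathbb{F}_q$ (here $n=3$). A polynomial $f\in\mathbb{F}_{Q}[X]$ is a permutation polynomial over $\mathbb{F}_{Q}$ if the map $c\mapsto f(c)$ is a bijection of $\mathbb{F}_{Q}$ to itself. *)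

theory Defs
  imports "HOL-Algebra.Algebraic_Closure_Type" "HOL-Library.Cardinality"
begin

(* The relative trace from the field with q^n elements to the field with q elements.
   It is polymorphic so that it can be applied to polynomials as well as to field elements. *)
definition rel_trace :: "nat \<Rightarrow> nat \<Rightarrow> 'a \<Rightarrow> 'a :: comm_semiring_1" where
  "rel_trace q n x = (\<Sum>i<n. x ^ (q ^ i))"

definition permutation_poly :: "'a :: finite_field poly \<Rightarrow> bool" where
  "permutation_poly f \<longleftrightarrow> bij (poly f)"

abbreviation polyX :: "'a :: comm_semiring_1 poly" where
  "polyX \<equiv> monom 1 1"

(* HOL-Algebra's subfield, for subsets of a field given as a type. *)
abbreviation is_subfield :: "'a :: finite_field set \<Rightarrow> bool" where
  "is_subfield K \<equiv> subfield K (ring_of_type_algebra :: 'a ring)"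

end

theory Submission
  imports Defs "HOL-Number_Theory.Residues"
begin

text \<open>
  Let \<open>Q(x) = Tr(x\<^sup>2 + x\<^sup>q\<^sup>+\<^sup>1)\<close>. In characteristic 2, with \<open>y = x\<^sup>q\<close> and \<open>z = y\<^sup>q\<close>,
  \<open>Q(x) = (x + y)\<^sup>2 + (x + y) (y + z) + (y + z)\<^sup>2\<close>, so \<open>Q\<close> takes values in \<open>F\<^sub>q\<close> and is invariant
  under translation by \<open>F\<^sub>q\<close>. If \<open>\<gamma> \<in> F\<^sub>q\<close>, then \<open>f(x) = f(x')\<close> forces \<open>x - x' \<in> F\<^sub>q\<close>, hence
  \<open>Q(x) = Q(x')\<close> and \<open>x = x'\<close>. The polar form of \<open>Q\<close> is \<open>Q(x + \<gamma>) - Q(x) - Q(\<gamma>) = Tr(x \<beta>)\<close>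
  with \<open>\<beta> = \<gamma>\<^sup>q + (\<gamma>\<^sup>q)\<^sup>q\<close>. If \<open>\<gamma> \<notin> F\<^sub>q\<close>, then \<open>\<beta> \<noteq> 0\<close>, so some \<open>x\<close> has
  \<open>Tr(x \<beta>) = 1 + Q(\<gamma>)\<close>; then \<open>Q(x + \<gamma>) = Q(x) + 1\<close> and \<open>f(x + \<gamma>) = f(x)\<close>.
\<close>

lemma poly_rel_trace: "poly (rel_trace q n p) x = rel_trace q n (poly p x)"
  by (simp add: rel_trace_def poly_sum)

text \<open>As a polynomial the trace has coefficient 1 at \<open>X\<close>, hence is nonzero, and
  its degree is at most \<open>q ^ (n - 1)\<close>, so it cannot vanish on the whole field.\<close>

lemma exists_rel_trace_nonzero:
  assumes "q > 1" "n > 0" "q ^ (n - 1) < CARD('a :: finite_field)"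
  shows "\<exists>x :: 'a. rel_trace q n x \<noteq> 0"
proof (rule ccontr)
  assume "\<not> (\<exists>x :: 'a. rel_trace q n x \<noteq> 0)"
  define p :: "'a poly" where "p = rel_trace q n polyX"
  have p: "p = (\<Sum>i<n. monom 1 (q ^ i))"
    by (simp add: p_def rel_trace_def monom_power)
  have "coeff p 1 = (\<Sum>i<n. if i = 0 then 1 else 0)"
    unfolding p coeff_sum using assms(1) by (intro sum.cong) auto
  then have "p \<noteq> 0"
    using assms(2) by auto
  moreover have "degree p \<le> q ^ (n - 1)"
    unfolding p using assms(1)
    by (intro degree_sum_le) (auto intro!: order.trans[OF degree_monom_le] power_increasing)
  moreover have "{x. poly p x = 0} = UNIV"
    using \<open>\<not> (\<exists>x :: 'a. rel_trace q n x \<noteq> 0)\<close> by (simp add: p_def poly_rel_trace poly_monom)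
  ultimately show False
    using card_poly_roots_bound[of p] assms(3) by simp
qed

text \<open>Elements of \<open>K\<close> are roots of \<open>X^q - X\<close>, which has at most
  \<open>q = card K\<close> roots, so the inclusion is an equality.\<close>

lemma subfield_eq_fixed_points:
  fixes K :: "'a :: finite_field set"
  assumes "is_subfield K" "card K = q" "q > 1"
  shows "K = {c. c ^ q = c}"
proof (rule card_seteq)
  have K: "0 \<in> K" "\<And>a b. a \<in> K \<Longrightarrow> b \<in> K \<Longrightarrow> a * b \<in> K"
    using subringE(2,6)[OF subfieldE(1)[OF assms(1)]] by (auto simp: ring_of_type_algebra_def)
  show "K \<subseteq> {c. c ^ q = c}"
  proof safe
    fix c assume c: "c \<in> K"
    show "c ^ q = c"
    proof (cases "c = 0")
      case False
      \<comment> \<open>Fermat's argument: multiplication by \<open>c\<close> permutes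
        \<open>K - {0}\<close>, and comparing the products of all elements gives
        \<open>c ^ (q - 1) = 1\<close>.\<close>
      have inj: "inj_on ((*) c) (K - {0})"
        using False by (auto simp: inj_on_def)
      have img: "(*) c ` (K - {0}) = K - {0}"
        by (rule endo_inj_surj[OF _ _ inj]) (use c False K in auto)
      have "\<Prod>(K - {0}) = (\<Prod>y\<in>K - {0}. c * y)"
        using prod.reindex[OF inj, of id] by (simp add: img)
      also have "\<dots> = c ^ (q - 1) * \<Prod>(K - {0})"
        using K(1) assms(2) by (simp add: prod.distrib card_Diff_singleton)
      finally have "c ^ (q - 1) = 1"
        by simp
      then show ?thesis
        using assms(3) by (metis Suc_diff_1 less_trans mult.right_neutral power_Suc zero_less_one)
    qed (use assms(3) in auto)
  qed
  define p :: "'a poly" where "p = monom 1 q - monom 1 1"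
  have "coeff p q = 1"
    using assms(3) by (simp add: p_def)
  then have "p \<noteq> 0"
    by auto
  moreover have "degree p \<le> q"
    unfolding p_def using assms(3) by (intro degree_diff_le) (auto simp: degree_monom_eq)
  moreover have "{x. poly p x = 0} = {c. c ^ q = c}"
    by (simp add: p_def poly_monom)
  ultimately show "card {c::'a. c ^ q = c} \<le> card K"
    using card_poly_roots_bound[of p] assms(2) by simp
qed simp

lemma CHAR_eq_2:
  assumes "CARD('a :: finite_field) = 2 ^ k"
  shows "CHAR('a) = 2"
proof -
  have "CHAR('a) dvd 2 ^ k"
    using CHAR_dvd_CARD[where 'a = 'a] assms by simp
  then show ?thesis
    using prime_dvd_power primes_dvd_imp_eq two_is_prime_nat prime_CHAR_semidom CHAR_pos
    by metis
qed

lemma rel_trace_3: "rel_trace q 3 x = x + x ^ q + (x ^ q) ^ q"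
  by (simp add: rel_trace_def eval_nat_numeral power_mult)

theorem theorem3p1:
  fixes m q :: nat and \<gamma> :: "'a :: finite_field" and Fq :: "'a set" and f :: "'a poly"
  assumes "m > 0" and "q = 2 ^ m"
    and "CARD('a) = q ^ 3"
    and "is_subfield Fq" and "card Fq = q"
    and "f = polyX + smult \<gamma> (rel_trace q 3 (polyX ^ 2 + polyX ^ (q + 1)))"
  shows "permutation_poly f \<longleftrightarrow> \<gamma> \<in> Fq"
proof -
  have q: "q > 1"
    using one_less_power[of "2::nat" m] assms(1,2) by simp
  have char: "CHAR('a) = 2"
    using CHAR_eq_2[where 'a = 'a] assms(2,3) by (simp flip: power_mult)
  have two: "(2 :: 'a) = 0"
    using of_nat_CHAR[where 'a = 'a] by (simp add: char)
  have double: "x + x = 0" "x + (x + y) = y" for x y :: 'a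
    using two by (simp_all flip: mult_2 add.assoc)
  have eq_iff: "x = y \<longleftrightarrow> x + y = 0" for x y :: 'a
    by (metis double add.right_neutral)
  have frob_add: "(x + y) ^ q = x ^ q + y ^ q" for x y :: 'a
    using freshmans_dream'[where 'a = 'a] assms(2) by (simp add: char)
  have frob3: "((x ^ q) ^ q) ^ q = x" for x :: 'a
    using finite_field_power_card_eq_same[of x]
    by (simp add: assms(3) power_mult eval_nat_numeral)
  note frob = frob_add power_mult_distrib frob3
  have Fq: "c \<in> Fq \<longleftrightarrow> c ^ q = c" for c
    using subfield_eq_fixed_points[OF assms(4,5) q] by blast
  define Q :: "'a \<Rightarrow> 'a" where "Q x = rel_trace q 3 (x ^ 2 + x * x ^ q)" for x
  have Q: "Q x = x * x + x * x ^ q + (x ^ q * x ^ q + x ^ q * (x ^ q) ^ q)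
      + ((x ^ q) ^ q * (x ^ q) ^ q + (x ^ q) ^ q * x)" for x
    by (simp add: Q_def rel_trace_3 frob power2_eq_square)
  have Q_Fq: "Q x ^ q = Q x" for x
    unfolding Q by (simp add: frob ac_simps)
  have poly_f: "poly f x = x + \<gamma> * Q x" for x
    by (simp add: assms(6) Q_def poly_rel_trace poly_monom)
  have perm: "permutation_poly f \<longleftrightarrow> inj (poly f)"
    unfolding permutation_poly_def bij_def using finite_UNIV_inj_surj[OF finite] by blast
  have "inj (poly f)" if "\<gamma> \<in> Fq"
  proof (rule injI)
    fix x x' assume eq: "poly f x = poly f x'"
    have trans: "Q (x + c) = Q x" if "c ^ q = c" for c
    proof -
      \<comment> \<open>The terms involving \<open>c\<close> collect into an explicit multiple of 2,
        so plain ring normalization suffices here.\<close>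
      have "Q (x + c) = Q x + 2 * (c * (2 * (x + x ^ q + (x ^ q) ^ q) + 3 * c))"
        unfolding Q by (simp add: frob that algebra_simps)
      then show ?thesis
        by (simp add: two)
    qed
    \<comment> \<open>This is the difference of \<open>x'\<close> and \<open>x\<close> that
      \<open>eq\<close> forces; signs do not matter in characteristic 2.\<close>
    define c where "c = \<gamma> * (Q x + Q x')"
    have x': "x' = x + c"
    proof -
      have "x + c = (x + \<gamma> * Q x) + \<gamma> * Q x'"
        by (simp add: c_def algebra_simps)
      also have "\<dots> = (x' + \<gamma> * Q x') + \<gamma> * Q x'"
        using eq by (simp add: poly_f)
      also have "\<dots> = x'"
        by (simp add: add.assoc double)
      finally show ?thesis ..
    qed
    have "c ^ q = c"
      using that by (simp add: c_def frob Q_Fq Fq)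
    then have "Q x' = Q x"
      using trans x' by simp
    then have "c = 0"
      by (simp add: c_def double)
    then show "x = x'"
      using x' by simp
  qed
  moreover have "\<not> inj (poly f)" if "\<gamma> \<notin> Fq"
  proof -
    define \<beta> where "\<beta> = \<gamma> ^ q + (\<gamma> ^ q) ^ q"
    have "\<beta> \<noteq> 0"
    proof
      assume "\<beta> = 0"
      then have "(\<gamma> ^ q) ^ q = \<gamma> ^ q"
        unfolding \<beta>_def using eq_iff by metis
      \<comment> \<open>Raising to the power \<open>q\<close> once more turns the left side into
        \<open>\<gamma>\<close>, by \<open>frob3\<close>.\<close>
      then have "\<gamma> ^ q = \<gamma>"
        by (metis frob3)
      with that Fq show False
        by blast
    qed
    have "q ^ (3 - 1) < CARD('a)"
      unfolding assms(3) using q by (intro power_strict_increasing) auto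
    from exists_rel_trace_nonzero[OF q _ this] obtain u :: 'a where u: "rel_trace q 3 u \<noteq> 0"
      by auto
    have "rel_trace q 3 u ^ q = rel_trace q 3 u"
      by (simp add: rel_trace_3 frob ac_simps)
    \<comment> \<open>A scalar fixed by \<open>q\<close>-th powers passes through the trace, so
      \<open>d * u\<close> has the prescribed trace \<open>1 + Q \<gamma>\<close>.\<close>
    define d where "d = (1 + Q \<gamma>) / rel_trace q 3 u"
    have d: "d ^ q = d"
      by (simp add: d_def frob power_divide Q_Fq \<open>rel_trace q 3 u ^ q = _\<close>)
    define x where "x = d * u / \<beta>"
    have "x * \<beta> = d * u"
      using \<open>\<beta> \<noteq> 0\<close> by (simp add: x_def)
    then have "rel_trace q 3 (x * \<beta>) = d * rel_trace q 3 u"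
      by (simp add: rel_trace_3 power_mult_distrib d algebra_simps)
    also have "\<dots> = 1 + Q \<gamma>"
      using u by (simp add: d_def)
    finally have tr: "rel_trace q 3 (x * \<beta>) = 1 + Q \<gamma>" .
    \<comment> \<open>The mixed products regroup as the trace of \<open>x * \<beta>\<close>; the
      squares contribute only the multiple of 2.\<close>
    have "Q (x + \<gamma>) = Q x + Q \<gamma> + rel_trace q 3 (x * \<beta>)
        + 2 * (x * \<gamma> + x ^ q * \<gamma> ^ q + (x ^ q) ^ q * (\<gamma> ^ q) ^ q)"
      unfolding Q rel_trace_3 \<beta>_def by (simp add: frob algebra_simps)
    then have "Q (x + \<gamma>) = Q x + 1"
      unfolding tr by (simp add: two double ac_simps)
    then have "poly f (x + \<gamma>) = poly f x"
      by (simp add: poly_f algebra_simps double)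
    moreover have "x + \<gamma> \<noteq> x"
      using that Fq[of 0] q by auto
    ultimately show ?thesis
      by (metis injD)
  qed
  ultimately show ?thesis
    using perm by blast
qed

end
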